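(* Let $n,m$ be positive integers with $n>2m$, and write $m=2^a3^bM$ and $n-2m=2^p3^qN$ with $a,b,p,q\ge 0$ integers and $M,N$ positive integers coprime to $6$. If $f(x)=x^n-x^m-1$ is reducible over $\mathbb{Q}$, then $q>b$, $e(m)>e(n-2m)$, and $f(x)$ is divisible by $\Phi_6(x^{\gcd(n,m)})$.
   Context: For a positive integer $r$, $e(r)$ denotes the largest power of $2$ dividing $r$ (so if $r=2^{c}r_1$ with $r_1$ odd then $e(r)=2^c$). $\Phi_6(x)=x^2-x+1$ is the $6$th cyclotomic polynomial. *)

theory Defs
  imports "HOL-Computational_Algebra.Computational_Algebra"
begin

definition two_part :: "nat \<Rightarrow> nat" where
  "two_part r = 2 ^ multiplicity 2 r"

definition Phi6 :: "rat poly" where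
  "Phi6 = monom 1 2 - monom 1 1 + 1"

definition trinomial :: "nat \<Rightarrow> nat \<Rightarrow> rat poly" where
  "trinomial n m = monom 1 n - monom 1 m - 1"

end

theory Submission
  imports Defs
begin

text \<open>
  Ljunggren's method. By Gauss's lemma a reducible \<open>f = x^n - x^m - 1\<close> splits as \<open>G * H\<close> over the
  integers. Writing \<open>p*\<close> for the reciprocal polynomial, \<open>F = G H*\<close> satisfies \<open>F F* = f f*\<close>. The middle
  coefficient of this product is the sum of the squared coefficients, so it forces \<open>F\<close> to have
  exactly three nonzero coefficients, all \<open>\<plusminus>1\<close>; comparing two further coefficients gives
  \<open>F = \<plusminus>f\<close> or \<open>F = \<plusminus>f*\<close>. Hence \<open>G\<close> or \<open>H\<close> is reciprocal up to sign, and \<open>f\<close> has complex roots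
  \<open>z\<close> and \<open>1/z\<close>. This makes \<open>z^m\<close> a primitive cube root of unity and \<open>z^(n - 2 m) = -1\<close>, so that
  \<open>z^gcd(n, m)\<close> is a primitive sixth root of unity, which determines \<open>n / gcd(n, m)\<close> and
  \<open>m / gcd(n, m)\<close> modulo 6.
\<close>

section \<open>Integer polynomials inside larger rings, and Gauss's lemma\<close>

lemma map_poly_of_int_mult:
  "map_poly (of_int :: int \<Rightarrow> 'a::comm_ring_1) (p * q) = map_poly of_int p * map_poly of_int q"
  by (rule poly_eqI) (simp add: coeff_map_poly coeff_mult)

lemma map_poly_of_int_smult:
  "map_poly (of_int :: int \<Rightarrow> 'a::comm_ring_1) (smult c p) = smult (of_int c) (map_poly of_int p)"
  by (rule poly_eqI) (simp add: coeff_map_poly)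

lemma map_poly_of_int_inject:
  assumes "map_poly (of_int :: int \<Rightarrow> 'a::ring_char_0) p = map_poly of_int q"
  shows "p = q"
proof (rule poly_eqI)
  fix i
  have "coeff (map_poly (of_int :: int \<Rightarrow> 'a) p) i = coeff (map_poly of_int q) i"
    using assms by simp
  then show "coeff p i = coeff q i" by (simp add: coeff_map_poly)
qed

lemma degree_map_poly_of_int [simp]:
  "degree (map_poly (of_int :: int \<Rightarrow> 'a::ring_char_0) p) = degree p"
  by (cases "p = 0") (auto intro: map_poly_degree_eq)

lemma map_poly_of_int_reflect_poly:
  "map_poly (of_int :: int \<Rightarrow> 'a::ring_char_0) (reflect_poly p) = reflect_poly (map_poly of_int p)"
  by (rule poly_eqI) (simp add: coeff_map_poly coeff_reflect_poly)

lemma rat_poly_clear_denominators: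
  fixes p :: "rat poly"
  obtains c :: int and q :: "int poly"
  where "c > 0" "map_poly of_int q = smult (of_int c) p"
proof -
  have "\<exists>c q. (c::int) > 0 \<and> map_poly of_int q = smult (of_int c) p"
  proof (induction p rule: pCons_induct)
    case 0
    show ?case by (rule exI[of _ 1], rule exI[of _ 0]) simp
  next
    case (pCons a p)
    obtain c q where cq: "(c::int) > 0" "map_poly of_int q = smult (of_int c) p"
      using pCons.IH by blast
    obtain i j where ij: "a = of_int i / of_int j" "(j::int) > 0"
      by (metis quotient_of_div quotient_of_denom_pos surj_pair)
    have "map_poly of_int (pCons (c * i) (smult j q)) = smult (of_int (c * j)) (pCons a p)"
    proof (rule poly_eqI)
      fix k
      have "of_int (coeff q l) = of_int c * coeff p l" for l
        using arg_cong[OF cq(2), of "\<lambda>p. coeff p l"] by (simp add: coeff_map_poly)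
      then show "coeff (map_poly of_int (pCons (c * i) (smult j q))) k
          = coeff (smult (of_int (c * j)) (pCons a p)) k"
        using ij by (simp add: coeff_map_poly coeff_pCons split: nat.split)
    qed
    moreover have "c * j > 0" using cq ij by simp
    ultimately show ?case by blast
  qed
  then show ?thesis using that by blast
qed

text \<open>Gauss's lemma: clear the denominators of both rational factors and pass to primitive
  parts; content 1 removes the leftover constant.\<close>

lemma reducible_rat_imp_int_factors:
  fixes f :: "int poly"
  assumes "content f = 1" "degree f > 0"
    and "\<not> irreducible (map_poly of_int f :: rat poly)"
  obtains g h where "f = g * h" "degree g > 0" "degree h > 0"
proof -
  let ?f = "map_poly of_int f :: rat poly"
  have nz: "?f \<noteq> 0" using assms(2) by (metis degree_0 degree_map_poly_of_int less_irrefl)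
  have "\<not> is_unit ?f" using assms(2) nz by (simp add: is_unit_iff_degree)
  with nz assms(3) obtain g h where gh: "?f = g * h" "\<not> is_unit g" "\<not> is_unit h"
    unfolding irreducible_def by blast
  have deg: "degree g > 0" "degree h > 0"
    using gh nz by (metis gr0I is_unit_iff_degree mult_zero_left mult_zero_right)+
  obtain c G where G: "c > 0" "map_poly of_int G = smult (of_int c) g"
    by (rule rat_poly_clear_denominators)
  obtain d H where H: "d > 0" "map_poly of_int H = smult (of_int d) h"
    by (rule rat_poly_clear_denominators)
  have "map_poly (of_int :: int \<Rightarrow> rat) (smult (c * d) f) = map_poly of_int (G * H)"
    by (simp add: map_poly_of_int_mult map_poly_of_int_smult G H gh(1) mult.commute)
  then have "smult (c * d) f = G * H" by (rule map_poly_of_int_inject)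
  then have "primitive_part (smult (c * d) f) = primitive_part G * primitive_part H"
    by (simp add: primitive_part_mult)
  \<comment> \<open>The primitive part of \<open>smult (c * d) f\<close> keeps the sign of
    \<open>c * d\<close>, which is positive.\<close>
  moreover have "unit_factor (c * d) = 1" using G(1) H(1) by simp
  ultimately have "f = primitive_part G * primitive_part H"
    using assms(1) by (simp add: primitive_part_smult primitive_part_prim)
  moreover have "degree G = degree g"
    using arg_cong[OF G(2), of degree] G(1) by simp
  moreover have "degree H = degree h"
    using arg_cong[OF H(2), of degree] H(1) by simp
  ultimately show ?thesis using that deg by simp
qed

section \<open>Ljunggren's comparison of coefficients\<close>

lemma coeff_mult_reflect_poly:
  fixes p :: "'a::comm_ring_1 poly"
  assumes "j \<le> degree p"
  shows "coeff (p * reflect_poly p) j = (\<Sum>i\<le>j. coeff p i * coeff p (degree p - j + i))"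
  unfolding coeff_mult
proof (rule sum.cong)
  fix i assume "i \<in> {..j}"
  then have "degree p - (j - i) = degree p - j + i" using assms by auto
  then show "coeff p i * coeff (reflect_poly p) (j - i) = coeff p i * coeff p (degree p - j + i)"
    using assms by (simp add: coeff_reflect_poly)
qed simp

text \<open>A nonzero integer square below 4 is 1. The two ends therefore take exactly 2 of the
  total 3, and the remaining 1 belongs to a single interior index.\<close>

lemma sum_squares_eq_3_cases:
  fixes F :: "nat \<Rightarrow> int"
  assumes "(\<Sum>i\<le>n. (F i)\<^sup>2) = 3" "F 0 \<noteq> 0" "F n \<noteq> 0" "n > 0"
  obtains k where "0 < k" "k < n" "\<bar>F 0\<bar> = 1" "\<bar>F n\<bar> = 1" "\<bar>F k\<bar> = 1"
    "\<forall>i\<in>{..n} - {0, k, n}. F i = 0"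
proof -
  let ?S = "\<lambda>A. \<Sum>i\<in>A. (F i)\<^sup>2"
  have sq: "(F i)\<^sup>2 \<ge> 1" if "F i \<noteq> 0" for i
    using that by (smt (verit) zero_less_power2)
  have unit: "\<bar>x\<bar> = 1" if "x\<^sup>2 < 4" "x \<noteq> 0" for x :: int
    using that power2_less_imp_less[of "\<bar>x\<bar>" 2] by simp
  have "{..n} = insert 0 (insert n {0<..<n})" using assms(4) by auto
  then have tot: "(F 0)\<^sup>2 + (F n)\<^sup>2 + ?S {0<..<n} = 3"
    using assms(1,4) by simp
  have nn: "?S {0<..<n} \<ge> 0" by (simp add: sum_nonneg)
  have F0: "\<bar>F 0\<bar> = 1" and Fn: "\<bar>F n\<bar> = 1"
    using unit[of "F 0"] unit[of "F n"] sq[of 0] sq[of n] tot nn assms by auto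
  have "(F 0)\<^sup>2 = 1" "(F n)\<^sup>2 = 1"
    using F0 Fn by (metis one_power2 power2_abs)+
  with tot have S: "?S {0<..<n} = 1" by simp
  then obtain k where k: "k \<in> {0<..<n}" "F k \<noteq> 0"
    by (metis (no_types, lifting) sum.neutral zero_neq_one zero_eq_power2)
  have split: "?S {0<..<n} = (F k)\<^sup>2 + ?S ({0<..<n} - {k})"
    using k by (simp add: sum.remove)
  have nn': "?S ({0<..<n} - {k}) \<ge> 0" by (simp add: sum_nonneg)
  have "\<bar>F k\<bar> = 1" using unit[of "F k"] k split S nn' by simp
  moreover have "?S ({0<..<n} - {k}) = 0" using split S nn' sq[OF k(2)] by simp
  then have "F i = 0" if "i \<in> {0<..<n} - {k}" for i
    using that by (subst (asm) sum_nonneg_eq_0_iff) auto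
  ultimately show ?thesis using that[of k] k F0 Fn by auto
qed

text \<open>Integer copy of \<open>trinomial\<close>: the argument with sums of squares relies on
  integer coefficients.\<close>

definition int_trinomial :: "nat \<Rightarrow> nat \<Rightarrow> int poly" where
  "int_trinomial n m = monom 1 n - monom 1 m - 1"

lemma map_poly_int_trinomial: "map_poly of_int (int_trinomial n m) = trinomial n m"
  by (rule poly_eqI) (simp add: coeff_map_poly int_trinomial_def trinomial_def)

lemma coeff_int_trinomial:
  assumes "0 < m" "m < n"
  shows "coeff (int_trinomial n m) i = (if i = n then 1 else if i = m \<or> i = 0 then -1 else 0)"
  using assms by (auto simp: int_trinomial_def)

lemma degree_int_trinomial:
  assumes "0 < m" "m < n"
  shows "degree (int_trinomial n m) = n"
proof (rule antisym)
  show "degree (int_trinomial n m) \<le> n"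
    using assms by (intro degree_le) (auto simp: coeff_int_trinomial)
  show "n \<le> degree (int_trinomial n m)"
    using assms by (intro le_degree) (simp add: coeff_int_trinomial)
qed

text \<open>Coefficient 0 of the product gives opposite signs at the ends of \<open>F\<close>,
  coefficient \<open>n\<close> leaves one middle term, and coefficient \<open>m\<close> locates that
  term up to reflection.\<close>

lemma eq_int_trinomial_or_reflect:
  assumes "0 < m" "2 * m < n" and deg: "degree F = n"
    and eq: "F * reflect_poly F = int_trinomial n m * reflect_poly (int_trinomial n m)"
  shows "\<exists>s. \<bar>s\<bar> = 1 \<and>
    (F = smult s (int_trinomial n m) \<or> F = smult s (reflect_poly (int_trinomial n m)))"
proof -
  let ?f = "int_trinomial n m"
  have mn: "m < n" using assms by simp
  note cf = coeff_int_trinomial[OF assms(1) mn] and df = degree_int_trinomial[OF assms(1) mn]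
  have coeffs_eq: "(\<Sum>i\<le>j. coeff F i * coeff F (n - j + i)) = (\<Sum>i\<le>j. coeff ?f i * coeff ?f (n - j + i))"
    if "j \<le> n" for j
    using that coeff_mult_reflect_poly[of j F] coeff_mult_reflect_poly[of j ?f] eq
    by (simp add: deg df)
  have c0: "coeff F 0 * coeff F n = -1"
    using coeffs_eq[of 0] assms by (simp add: cf)
  have "(\<Sum>i\<le>n. (coeff F i)\<^sup>2) = (\<Sum>i\<le>n. (coeff ?f i)\<^sup>2)"
    using coeffs_eq[of n] by (simp add: power2_eq_square)
  also have "\<dots> = (\<Sum>i\<in>{0, m, n}. (coeff ?f i)\<^sup>2)"
    using mn by (intro sum.mono_neutral_right) (auto simp: cf)
  also have "\<dots> = 3" using assms by (simp add: cf)
  finally have three: "(\<Sum>i\<le>n. (coeff F i)\<^sup>2) = 3" .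
  have "coeff F 0 \<noteq> 0" "coeff F n \<noteq> 0" "n > 0" using c0 mn by auto
  with three obtain k where k: "0 < k" "k < n" "\<bar>coeff F 0\<bar> = 1" "\<bar>coeff F n\<bar> = 1"
    "\<bar>coeff F k\<bar> = 1" "\<forall>i\<in>{..n} - {0, k, n}. coeff F i = 0"
    by (rule sum_squares_eq_3_cases)
  have zero: "coeff F i = 0" if "i \<le> n" "i \<noteq> 0" "i \<noteq> k" "i \<noteq> n" for i
    using k(6) that by blast
  \<comment> \<open>For \<open>0 < i < m\<close> the positions \<open>i\<close> and
    \<open>n - m + i\<close> are distinct and interior, so at most one of them is \<open>l\<close>
    and the product vanishes. Used for \<open>F\<close> with \<open>l = k\<close> and for
    \<open>?f\<close> with \<open>l = m\<close>.\<close>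
  have ends: "(\<Sum>i\<le>m. g i * g (n - m + i)) = g 0 * g (n - m) + g m * g n"
    if g: "\<And>i. i \<le> n \<Longrightarrow> i \<noteq> 0 \<Longrightarrow> i \<noteq> l \<Longrightarrow> i \<noteq> n \<Longrightarrow> g i = 0" for g :: "nat \<Rightarrow> int" and l
  proof -
    have "(\<Sum>i\<le>m. g i * g (n - m + i)) = (\<Sum>i\<in>{0, m}. g i * g (n - m + i))"
    proof (rule sum.mono_neutral_right)
      show "\<forall>i\<in>{..m} - {0, m}. g i * g (n - m + i) = 0"
      proof
        fix i assume i: "i \<in> {..m} - {0, m}"
        have "g i = 0 \<or> g (n - m + i) = 0"
        proof (cases "i = l")
          case True
          have "g (n - m + i) = 0"
            by (rule g) (use True i assms(1,2) in auto)
          then show ?thesis ..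
        next
          case False
          have "g i = 0"
            by (rule g) (use False i assms(1,2) in auto)
          then show ?thesis ..
        qed
        then show "g i * g (n - m + i) = 0" by auto
      qed
    qed auto
    also have "\<dots> = g 0 * g (n - m) + g m * g n" using assms by simp
    finally show ?thesis .
  qed
  \<comment> \<open>Since \<open>2 * m < n\<close>, the index \<open>n - m\<close> differs from
    \<open>0\<close>, \<open>m\<close> and \<open>n\<close>, so on the side of \<open>?f\<close>
    only the product of its coefficients at \<open>m\<close> and \<open>n\<close> survives.\<close>
  have cm: "coeff F 0 * coeff F (n - m) + coeff F m * coeff F n = -1"
  proof -
    have "coeff F 0 * coeff F (n - m) + coeff F m * coeff F n
        = (\<Sum>i\<le>m. coeff F i * coeff F (n - m + i))"
      using ends[of k "coeff F"] zero by simp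
    also have "\<dots> = (\<Sum>i\<le>m. coeff ?f i * coeff ?f (n - m + i))"
      using coeffs_eq[of m] mn by simp
    also have "\<dots> = coeff ?f 0 * coeff ?f (n - m) + coeff ?f m * coeff ?f n"
      by (rule ends[of m]) (simp add: cf)
    also have "\<dots> = -1"
    proof -
      have "n - m \<noteq> n" "n - m \<noteq> m" "n - m \<noteq> 0" using assms(1,2) by auto
      then show ?thesis using mn by (simp add: cf)
    qed
    finally show ?thesis .
  qed
  \<comment> \<open>In the last case both products in \<open>cm\<close> vanish, contradicting the
    value -1.\<close>
  consider "k = m" | "k = n - m" "k \<noteq> m" | "k \<noteq> m" "k \<noteq> n - m" by blast
  then show ?thesis
  proof cases
    case 1
    have F: "coeff F m * coeff F n = -1"
      using cm zero[of "n - m"] 1 assms by simp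
    have "F = smult (coeff F n) ?f"
    proof (rule poly_eqI)
      fix i
      have "coeff F 0 = - coeff F n" "coeff F m = - coeff F n"
        using c0 F k 1 by (auto simp: abs_if split: if_splits)
      moreover have "coeff F i = 0" if "i > n" using that deg by (simp add: coeff_eq_0)
      ultimately show "coeff F i = coeff (smult (coeff F n) ?f) i"
        using zero[of i] 1 by (cases "i \<le> n") (auto simp: cf)
    qed
    then show ?thesis using k by blast
  next
    case 2
    have F: "coeff F 0 * coeff F k = -1"
      using cm zero[of m] 2 assms by simp
    \<comment> \<open>The reflected trinomial is \<open>1 - x^(n - m) - x^n\<close>, so the scalar
      is read off at index 0.\<close>
    have "F = smult (coeff F 0) (reflect_poly ?f)"
    proof (rule poly_eqI)
      fix i
      have "coeff F n = - coeff F 0" "coeff F k = - coeff F 0"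
        using c0 F k by (auto simp: abs_if split: if_splits)
      moreover have "coeff F i = 0" if "i > n" using that deg by (simp add: coeff_eq_0)
      ultimately show "coeff F i = coeff (smult (coeff F 0) (reflect_poly ?f)) i"
        using zero[of i] 2 mn assms(1)
        by (cases "i = 0"; cases "i \<le> n") (auto simp: cf coeff_reflect_poly df)
    qed
    then show ?thesis using k by blast
  next
    case 3
    then show ?thesis using cm zero[of m] zero[of "n - m"] assms by simp
  qed
qed

section \<open>From a factorization to a pair of reciprocal roots\<close>

lemma reducible_trinomial_has_reciprocal_factor:
  assumes "0 < m" "2 * m < n" and "\<not> irreducible (trinomial n m)"
  obtains D s where "D dvd int_trinomial n m" "degree D > 0" "\<bar>s\<bar> = 1"
    "reflect_poly D = smult s D"
proof -
  let ?f = "int_trinomial n m"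
  have mn: "m < n" using assms by simp
  note cf = coeff_int_trinomial[OF assms(1) mn] and df = degree_int_trinomial[OF assms(1) mn]
  have "content ?f dvd coeff ?f n" by (rule content_dvd_coeff)
  then have "content ?f = 1" using is_unit_content_iff[of ?f] by (simp add: cf)
  then obtain G H where GH: "?f = G * H" "degree G > 0" "degree H > 0"
    using reducible_rat_imp_int_factors[of ?f] assms df by (auto simp: map_poly_int_trinomial)
  \<comment> \<open>With nonzero constant coefficients, reflection preserves the degree and is an
    involution.\<close>
  have "coeff G 0 * coeff H 0 = -1"
    using GH(1) cf[of 0] mn by (simp add: coeff_mult_0)
  then have c0: "coeff G 0 \<noteq> 0" "coeff H 0 \<noteq> 0" by auto
  have nz: "G \<noteq> 0" "H \<noteq> 0" using GH by auto
  define F where "F = G * reflect_poly H"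
  have "F * reflect_poly F = ?f * reflect_poly ?f"
    using c0 by (simp add: F_def GH(1) reflect_poly_mult)
  moreover have "degree F = n"
    using df c0 nz by (simp add: F_def GH(1) degree_mult_eq)
  ultimately obtain s where s: "\<bar>s\<bar> = 1" "F = smult s ?f \<or> F = smult s (reflect_poly ?f)"
    using eq_int_trinomial_or_reflect assms by blast
  \<comment> \<open>Cancelling \<open>G\<close> in the first case, or \<open>reflect_poly H\<close>
    in the second, leaves one factor equal to its reflection up to sign.\<close>
  from s(2) show ?thesis
  proof
    assume "F = smult s ?f"
    then have "G * reflect_poly H = G * smult s H" by (simp add: F_def GH(1))
    then have "reflect_poly H = smult s H" using nz by (metis mult_left_cancel)
    then show ?thesis using that[of H s] GH s by simp
  next
    assume "F = smult s (reflect_poly ?f)"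
    then have "reflect_poly H * G = reflect_poly H * smult s (reflect_poly G)"
      by (simp add: F_def GH(1) reflect_poly_mult mult.commute)
    then have "G = smult s (reflect_poly G)" using nz by (metis mult_left_cancel reflect_poly_eq_0_iff)
    then have "smult s G = smult (s * s) (reflect_poly G)" by (metis smult_smult)
    moreover have "s * s = 1" using s(1) by (auto simp: abs_if split: if_splits)
    ultimately have "reflect_poly G = smult s G" by simp
    then show ?thesis using that[of G s] GH s by simp
  qed
qed

text \<open>The nonzero roots of a factor that is reciprocal up to sign are closed under inversion,
  so any complex root of it serves.\<close>

lemma reducible_trinomial_has_reciprocal_roots:
  assumes "0 < m" "2 * m < n" and "\<not> irreducible (trinomial n m)"
  obtains z :: complex where "z \<noteq> 0" "z ^ n = z ^ m + 1" "inverse z ^ n = inverse z ^ m + 1"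
proof -
  obtain D s where D: "D dvd int_trinomial n m" "degree D > 0" "\<bar>s\<bar> = 1"
    "reflect_poly D = smult s D"
    using assms by (rule reducible_trinomial_has_reciprocal_factor)
  let ?D = "map_poly of_int D :: complex poly"
  have "\<not> constant (poly ?D)" using D(2) by (simp add: constant_degree)
  then obtain z where z: "poly ?D z = 0" using fundamental_theorem_of_algebra by blast
  have f: "map_poly of_int (int_trinomial n m) = (monom 1 n - monom 1 m - 1 :: complex poly)"
    by (rule poly_eqI) (simp add: coeff_map_poly int_trinomial_def)
  have root: "w ^ n = w ^ m + 1" if "poly ?D w = 0" for w
  proof -
    obtain E where "int_trinomial n m = D * E" using D(1) by blast
    then have "poly (monom 1 n - monom 1 m - 1 :: complex poly) w = 0"
      using that by (simp flip: f add: map_poly_of_int_mult)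
    then show ?thesis by (simp add: poly_monom algebra_simps)
  qed
  have z0: "z \<noteq> 0" using root[OF z] assms by (auto simp: power_0_left)
  have "poly (reflect_poly ?D) z = 0"
    using D(4) z by (simp flip: map_poly_of_int_reflect_poly add: map_poly_of_int_smult)
  then have "poly ?D (inverse z) = 0" using z0 by (simp add: poly_reflect_poly_nz)
  then show ?thesis using that z0 root z by blast
qed

section \<open>Residues of the exponents modulo 6\<close>

lemma power_eq_1_gcd:
  fixes x :: "'a::comm_ring_1"
  assumes "x ^ i = 1" "x ^ j = 1" "i \<noteq> 0"
  shows "x ^ gcd i j = 1"
proof -
  obtain a b where "i * a = j * b + gcd i j" using bezout_nat assms(3) by blast
  then have "x ^ (i * a) = x ^ (j * b) * x ^ gcd i j" by (simp add: power_add)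
  then show ?thesis using assms by (simp add: power_mult)
qed

text \<open>With \<open>u = y^m\<close> the equations become \<open>y^n = u + 1\<close> and
  \<open>1/(u + 1) = 1/u + 1\<close>, whence \<open>u^2 + u + 1 = 0\<close>. Coprimality then gives
  \<open>y^6 = 1\<close>, and deciding which powers of \<open>y\<close> equal 1 fixes the
  residues.\<close>

lemma reciprocal_roots_imp_cong_6:
  fixes y :: complex
  assumes "coprime n m" "0 < m" "2 * m < n" and y0: "y \<noteq> 0"
    and y: "y ^ n = y ^ m + 1" "inverse y ^ n = inverse y ^ m + 1"
  shows "m mod 6 = 2 \<and> n mod 6 = 1 \<or> m mod 6 = 4 \<and> n mod 6 = 5"
proof -
  define u where "u = y ^ m"
  have u0: "u \<noteq> 0" using y0 by (simp add: u_def)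
  have yn: "y ^ n = u + 1" using y by (simp add: u_def)
  have "u + 1 \<noteq> 0" using yn y0 by (metis power_not_zero)
  moreover have "inverse (u + 1) = inverse u + 1"
    using y(2) by (simp add: power_inverse yn u_def[symmetric])
  ultimately have quad: "u\<^sup>2 + u + 1 = 0"
    using u0 by (simp add: field_simps power2_eq_square)
  have "u ^ 3 - 1 = (u - 1) * (u\<^sup>2 + u + 1)" by (simp add: algebra_simps power2_eq_square power3_eq_cube)
  then have u3: "u ^ 3 = 1" using quad by simp
  have u1: "u \<noteq> 1" using quad by auto
  have yn': "y ^ n = - u\<^sup>2" using quad yn by (simp add: eq_neg_iff_add_eq_0 algebra_simps)
  have n3: "y ^ (n * 3) = -1"
  proof -
    have "(- u\<^sup>2) ^ 3 = - ((u ^ 3)\<^sup>2)" by (simp flip: power_mult)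
    then show ?thesis by (simp add: power_mult yn' u3)
  qed
  have m3: "y ^ (m * 3) = 1" by (simp add: power_mult u3 flip: u_def)
  have n6: "y ^ (n * 6) = 1"
  proof -
    have "y ^ (n * 6) = (y ^ (n * 3))\<^sup>2" by (simp flip: power_mult add: mult.commute)
    then show ?thesis by (simp add: n3)
  qed
  have m6: "y ^ (m * 6) = 1"
  proof -
    have "y ^ (m * 6) = (y ^ (m * 3))\<^sup>2" by (simp flip: power_mult add: mult.commute)
    then show ?thesis by (simp add: m3)
  qed
  have "gcd (m * 6) (n * 6) = 6"
    using assms(1) by (simp add: gcd_mult_distrib_nat[symmetric] gcd.commute coprime_iff_gcd_eq_1 mult.commute[of _ 6])
  then have y6: "y ^ 6 = 1"
    using power_eq_1_gcd[OF m6 n6] assms(2) by simp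
  have red: "y ^ i = y ^ (i mod 6)" for i
  proof -
    have "y ^ i = (y ^ 6) ^ (i div 6) * y ^ (i mod 6)"
      by (simp flip: power_mult power_add)
    then show ?thesis by (simp add: y6)
  qed
  have y3: "y ^ 3 \<noteq> 1"
  proof
    assume "y ^ 3 = 1"
    then have "y ^ (n * 3) = 1" by (simp add: mult.commute[of n] power_mult)
    then show False using n3 by simp
  qed
  \<comment> \<open>An odd \<open>m\<close> has \<open>3 * m\<close> congruent to 3 modulo 6, so
    \<open>m3\<close> would give \<open>y^3 = 1\<close>.\<close>
  have ev: "even m"
  proof (rule ccontr)
    assume "odd m"
    then have "m * 3 mod 6 = 3" by presburger
    then show False using red[of "m * 3"] m3 y3 by simp
  qed
  have odd: "odd n" using ev assms(1) by (meson coprime_common_divisor odd_one)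
  have m2: "m mod 6 \<noteq> 0" using red[of m] u1 by (metis power_0 u_def)
  have y2: "y ^ 2 \<noteq> 1"
  proof
    assume "y ^ 2 = 1"
    moreover obtain l where "m = 2 * l" using ev by blast
    ultimately show False using u1 by (simp add: u_def power_mult)
  qed
  \<comment> \<open>Indeed \<open>y^(n + m) = - u^3 = -1\<close>. As neither \<open>y^2\<close> nor
    \<open>y^4\<close> is 1, the exponent \<open>2 * (n + m)\<close> must vanish modulo 6, so 3
    divides \<open>n + m\<close>.\<close>
  have "y ^ ((n + m) * 2) = 1"
  proof -
    have "y ^ ((n + m) * 2) = (y ^ n * y ^ m)\<^sup>2"
      by (simp only: power_mult power_add)
    also have "\<dots> = (- u\<^sup>2 * u)\<^sup>2" by (simp only: yn' u_def)
    also have "\<dots> = (u ^ 3)\<^sup>2" by (simp add: power2_eq_square power3_eq_cube)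
    finally show ?thesis by (simp add: u3)
  qed
  then have nm2: "y ^ ((n + m) * 2 mod 6) = 1" using red by metis
  have y4: "y ^ 4 \<noteq> 1"
  proof
    assume "y ^ 4 = 1"
    then have "y ^ 6 = y ^ 2" using power_add[of y 4 2] by simp
    then show False using y2 y6 by simp
  qed
  have "(n + m) * 2 mod 6 \<noteq> 2" "(n + m) * 2 mod 6 \<noteq> 4"
    using nm2 y2 y4 by auto
  then have "(n + m) mod 3 = 0" by presburger
  with m2 ev odd show ?thesis by presburger
qed

section \<open>Divisibility by the cyclotomic polynomial\<close>

text \<open>\<open>Phi6\<close> divides \<open>X^6 - 1\<close>, so exponents may be reduced modulo
  6; two explicit trinomials remain, settled by exhibiting their cofactors.\<close>

lemma Phi6_dvd_trinomial:
  assumes "m mod 6 = 2 \<and> n mod 6 = 1 \<or> m mod 6 = 4 \<and> n mod 6 = 5"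
  shows "Phi6 dvd trinomial n m"
proof -
  define X where "X = (monom 1 1 :: rat poly)"
  have mon: "monom 1 i = X ^ i" for i by (simp add: X_def monom_power)
  have Phi: "Phi6 = X ^ 2 - X + 1" by (simp add: Phi6_def mon)
  have "X ^ 6 - 1 = (X ^ 2 - X + 1) * ((X + 1) * (X ^ 3 - 1))"
    by (simp add: algebra_simps eval_nat_numeral)
  then have six: "Phi6 dvd X ^ 6 - 1" unfolding Phi by (metis dvd_triv_left)
  have red: "Phi6 dvd X ^ i - X ^ (i mod 6)" for i
  proof -
    have "X ^ i = (X ^ 6) ^ (i div 6) * X ^ (i mod 6)"
      by (simp flip: power_mult power_add)
    then have "X ^ i - X ^ (i mod 6) = ((X ^ 6) ^ (i div 6) - 1) * X ^ (i mod 6)"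
      by (simp add: algebra_simps)
    moreover have "X ^ 6 - 1 dvd (X ^ 6) ^ (i div 6) - 1"
      using power_diff_1_eq[of "X ^ 6"] by (metis dvd_triv_left)
    ultimately show ?thesis using six by (auto intro: dvd_mult2 dvd_trans)
  qed
  have "Phi6 dvd X ^ (n mod 6) - X ^ (m mod 6) - 1"
  proof -
    have "X ^ 1 - X ^ 2 - 1 = (X ^ 2 - X + 1) * (-1)"
      "X ^ 5 - X ^ 4 - 1 = (X ^ 2 - X + 1) * (X ^ 3 - X - 1)"
      by (simp_all add: algebra_simps eval_nat_numeral)
    then show ?thesis using assms unfolding Phi by (metis dvd_triv_left)
  qed
  then have "Phi6 dvd (X ^ n - X ^ (n mod 6)) - (X ^ m - X ^ (m mod 6))
      + (X ^ (n mod 6) - X ^ (m mod 6) - 1)"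
    by (rule dvd_add[OF dvd_diff[OF red red]])
  then show ?thesis by (simp add: trinomial_def mon algebra_simps)
qed

text \<open>Substituting \<open>x^g\<close> for \<open>x\<close> carries divisibility from coprime
  exponents to arbitrary ones.\<close>

lemma pcompose_trinomial_monom:
  "pcompose (trinomial n m) (monom 1 g) = trinomial (g * n) (g * m)"
proof -
  have "pcompose (monom 1 i) (monom 1 g) = (monom 1 (g * i) :: rat poly)" for i
  proof (induction i)
    case (Suc i)
    have "monom 1 (Suc i) = monom 1 i * (monom 1 1 :: rat poly)" by (simp add: mult_monom)
    then have "pcompose (monom 1 (Suc i)) (monom 1 g)
        = monom 1 (g * i) * pcompose (monom 1 1) (monom 1 g :: rat poly)"
      by (simp only: pcompose_mult Suc.IH)
    also have "pcompose (monom 1 1) (monom 1 g) = (monom 1 g :: rat poly)"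
      by (simp add: monom_altdef pcompose_pCons)
    finally show ?case by (simp add: mult_monom add.commute)
  qed (simp add: pcompose_1)
  then show ?thesis by (simp add: trinomial_def pcompose_diff pcompose_1)
qed

section \<open>Reduction to coprime exponents and comparison of valuations\<close>

theorem theorem4:
  fixes n m a b p q M N :: nat
  assumes "n > 0" and "m > 0" and "n > 2 * m"
    and "M > 0" and "coprime M 6" and "m = 2 ^ a * 3 ^ b * M"
    and "N > 0" and "coprime N 6" and "n - 2 * m = 2 ^ p * 3 ^ q * N"
    and "\<not> irreducible (trinomial n m)"
  shows "q > b \<and> two_part m > two_part (n - 2 * m)
    \<and> pcompose Phi6 (monom 1 (gcd n m)) dvd trinomial n m"
proof -
  define g where "g = gcd n m"
  have g0: "g > 0" using assms(2) by (simp add: g_def)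
  obtain n' m' where nm: "n = g * n'" "m = g * m'" "coprime n' m'"
    unfolding g_def using gcd_coprime_exists[of n m] assms(2) by (metis gcd_eq_0_iff mult.commute not_gr0)
  have "2 * m' < n'"
    using assms(3) g0 unfolding nm(1,2) by (simp add: mult.left_commute)
  have "m' > 0" using assms(2) nm(2) by simp
  obtain z :: complex where z: "z \<noteq> 0" "z ^ n = z ^ m + 1" "inverse z ^ n = inverse z ^ m + 1"
    using assms(2,3,10) by (rule reducible_trinomial_has_reciprocal_roots)
  \<comment> \<open>The coprime case is applied to \<open>y = z^g\<close>, whose powers
    \<open>n'\<close> and \<open>m'\<close> are \<open>z^n\<close> and \<open>z^m\<close>.\<close>
  have cong: "m' mod 6 = 2 \<and> n' mod 6 = 1 \<or> m' mod 6 = 4 \<and> n' mod 6 = 5"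
  proof (rule reciprocal_roots_imp_cong_6)
    show "(z ^ g) ^ n' = (z ^ g) ^ m' + 1" "inverse (z ^ g) ^ n' = inverse (z ^ g) ^ m' + 1"
      using z by (simp_all add: nm flip: power_mult power_inverse)
  qed (use nm z \<open>m' > 0\<close> \<open>2 * m' < n'\<close> in auto)
  define k where "k = n' - 2 * m'"
  have k0: "k > 0" using \<open>2 * m' < n'\<close> by (simp add: k_def)
  have k: "n - 2 * m = g * k" by (simp add: k_def nm diff_mult_distrib2 mult.left_commute)
  \<comment> \<open>Both residue pairs make \<open>n' - 2 * m'\<close> congruent to -3 modulo 6:
    \<open>1 - 4\<close> and \<open>5 - 8\<close>.\<close>
  have k6: "k mod 6 = 3"
  proof -
    have "n' = k + 2 * m'" using \<open>2 * m' < n'\<close> by (simp add: k_def)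
    then show ?thesis using cong by presburger
  qed
  have "odd k" "3 dvd k" using k6 by presburger+
  have "\<not> 3 dvd m'" "even m'" using cong by presburger+
  have mult: "multiplicity r (g * l) = multiplicity r g + multiplicity r l"
    if "prime r" "l > 0" for r l :: nat
    using that g0 by (simp add: prime_elem_multiplicity_mult_distrib)
  have three: "multiplicity 3 (2 ^ i * 3 ^ j * L) = j" if "coprime L 6" "L > 0" for i j L :: nat
  proof -
    have "\<not> 3 dvd L" using that(1) coprime_common_divisor_nat[of L 6 3] by auto
    moreover have "\<not> (3::nat) dvd 2 ^ i" using prime_dvd_power[of "3::nat" 2 i] by auto
    ultimately show ?thesis
      using that by (simp add: prime_elem_multiplicity_mult_distrib not_dvd_imp_multiplicity_0)
  qed
  \<comment> \<open>As 3 does not divide \<open>m'\<close>, the exponent \<open>b\<close> comes from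
    \<open>g\<close> alone, while \<open>q\<close> also counts the factor 3 of
    \<open>k\<close>.\<close>
  have "b < q"
  proof -
    have "b = multiplicity 3 g"
      using three[of M a b] assms(4-6) mult[of 3 m'] \<open>m' > 0\<close> \<open>\<not> 3 dvd m'\<close> nm(2)
      by (simp add: not_dvd_imp_multiplicity_0)
    moreover have "q = multiplicity 3 g + multiplicity 3 k"
      using three[of N p q] assms(7-9) mult[of 3 k] k0 k by simp
    moreover have "multiplicity 3 k > 0" using \<open>3 dvd k\<close> k0 by (simp add: multiplicity_gt_zero_iff)
    ultimately show ?thesis by simp
  qed
  \<comment> \<open>Both numbers share the power of 2 in \<open>g\<close>; the even
    \<open>m'\<close> adds to it and the odd \<open>k\<close> does not.\<close>
  moreover have "two_part m > two_part (n - 2 * m)"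
  proof -
    have "multiplicity 2 m' > 0" using \<open>even m'\<close> \<open>m' > 0\<close> by (simp add: multiplicity_gt_zero_iff)
    then show ?thesis
      using mult[of 2 m'] mult[of 2 k] k0 \<open>m' > 0\<close> \<open>odd k\<close>
      unfolding two_part_def k by (simp add: nm(2) not_dvd_imp_multiplicity_0)
  qed
  moreover have "pcompose Phi6 (monom 1 g) dvd trinomial n m"
  proof -
    obtain Q where "trinomial n' m' = Phi6 * Q" using Phi6_dvd_trinomial[OF cong] by blast
    then have "trinomial n m = pcompose Phi6 (monom 1 g) * pcompose Q (monom 1 g)"
      unfolding nm(1,2) by (simp flip: pcompose_trinomial_monom add: pcompose_mult)
    then show ?thesis by simp
  qed
  ultimately show ?thesis by (simp add: g_def)
qed

end
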